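(* Let $0\le\alpha<1/2$. There is a deterministic algorithm for learning-augmented $k$-means clustering, namely the algorithm $\mathcal{A}$ described in the context, such that given a data set $P$ of $m$ points in $\mathbb{R}^d$ (i.e. $P\in\mathbb{R}^{m\times d}$) and a partition $(P_1,\dots,P_k)$ of $P$ with label error rate $\alpha$, it outputs centers $\widehat C=\{\widehat c_1,\dots,\widehat c_k\}\subset\mathbb{R}^d$ with $$\operatorname{cost}(P,\widehat C)\le\left(1+\left(\frac{\alpha}{1-\alpha}+\frac{4\alpha}{(1-2\alpha)(1-\alpha)}\right)\right)\mathrm{OPT},$$ and it runs in time $O(dm\log m)$.
   Context: For a finite set (multiset) $X\subset\mathbb{R}^d$ and a finite set of centers $C\subset\mathbb{R}^d$, the $k$-means cost is $\operatorname{cost}(X,C)=\sum_{p\in X}\min_{c\in C}\|p-c\|^2$ (Euclidean norm); for a single point $c$ write $\operatorname{cost}(X,c)=\sum_{p\in X}\|p-c\|^2$. $\mathrm{OPT}$ is the minimum of $\operatorname{cost}(P,C)$ over all sets $C$ of $k$ points in $\mathbb{R}^d$. $\overline{X}$ denotes the average of $X$. Label error rate: a partition $P=P_1\cup\dots\cup P_k$ into nonempty parts (given by a predictor) has label error rate $\alpha$ if there exist an (unknown) partition $P=P_1^*\cup\dots\cup P_k^*$ and centers $c_1^*,\dots,c_k^*$ with $\sum_{i=1}^k\operatorname{cost}(P_i^*,c_i^* )=\mathrm{OPT}$ and $|P_i\cap P_i^*|\ge(1-\alpha)\max(|P_i|,|P_i^*|)$ for every $i\in\{1,\dots,k\}$.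 The value $\alpha$ is known to the algorithm. Algorithm $\mathcal{A}$: put $m_i=|P_i|$. For each $i\in\{1,\dots,k\}$ and each coordinate $j\in\{1,\dots,d\}$, let $P_{i,j}\subset\mathbb{R}$ be the multiset of $j$-th coordinates of points of $P_i$, let $\omega_{i,j}$ be the collection of all sub-multisets consisting of $\lceil(1-\alpha)m_i\rceil$ contiguous points in the sorted order of $P_{i,j}$, and let $I_{i,j}\in\omega_{i,j}$ be the first minimizer of $\operatorname{cost}(Z,\overline{Z})=\sum_{z\in Z}z^2-\frac{1}{|Z|}\left(\sum_{z\in Z}z\right)^2$ over $Z\in\omega_{i,j}$. Set $\widehat c_i=(\overline{I_{i,j}})_{j=1}^d$ and return $\{\widehat c_1,\dots,\widehat c_k\}$. Running time is counted in elementary arithmetic operations and comparisons on real numbers. *)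

theory Defs
  imports
    Complex_Main
    "HOL-Library.Multiset"
    "HOL-Library.Disjoint_Sets"
    "HOL-Library.Monad_Syntax"
    "Jordan_Normal_Form.Matrix"
begin

section \<open>The clustering problem\<close>

definition sq_dist :: "real vec \<Rightarrow> real vec \<Rightarrow> real" where
  "sq_dist p c = (\<Sum>j<dim_vec p. (p $ j - c $ j)\<^sup>2)"

definition cost :: "real vec multiset \<Rightarrow> real vec set \<Rightarrow> real" where
  "cost X C = (\<Sum>p\<in>#X. Min (sq_dist p ` C))"

text \<open>A data set of \<open>m\<close> points in \<open>d\<close>-dimensional space is an \<open>m \<times> d\<close> matrix; the points are its
  rows. Parts of the data set are sets of row indices, so that repeated points remain
  distinguishable, and \<open>points P A\<close> is the multiset of the points with index in \<open>A\<close>.\<close>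

definition points :: "real mat \<Rightarrow> nat set \<Rightarrow> real vec multiset" where
  "points P A = image_mset (row P) (mset_set A)"

text \<open>For \<open>d \<ge> 1\<close> the infimum below is attained, so it is the minimum.\<close>

definition OPT :: "nat \<Rightarrow> real mat \<Rightarrow> real" where
  "OPT k P = Inf {cost (points P {..<dim_row P}) C | C.
     C \<subseteq> carrier_vec (dim_col P) \<and> finite C \<and> card C = k}"

definition indexed_partition :: "nat \<Rightarrow> 'a set \<Rightarrow> (nat \<Rightarrow> 'a set) \<Rightarrow> bool" where
  "indexed_partition k A Q \<longleftrightarrow> disjoint_family_on Q {..<k} \<and> (\<Union>i<k. Q i) = A"

definition has_label_error_rate :: "nat \<Rightarrow> real mat \<Rightarrow> (nat \<Rightarrow> nat set) \<Rightarrow> real \<Rightarrow> bool" where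
  "has_label_error_rate k P Q \<alpha> \<longleftrightarrow>
     indexed_partition k {..<dim_row P} Q \<and> (\<forall>i<k. Q i \<noteq> {}) \<and>
     (\<exists>Q' c'. indexed_partition k {..<dim_row P} Q' \<and>
        (\<forall>i<k. c' i \<in> carrier_vec (dim_col P)) \<and>
        (\<Sum>i<k. cost (points P (Q' i)) {c' i}) = OPT k P \<and>
        (\<forall>i<k. real (card (Q i \<inter> Q' i)) \<ge> (1 - \<alpha>) * real (max (card (Q i)) (card (Q' i)))))"


section \<open>The centers chosen by the algorithm\<close>

definition mean :: "real list \<Rightarrow> real" where
  "mean Z = sum_list Z / real (length Z)"

definition cost1 :: "real list \<Rightarrow> real \<Rightarrow> real" where
  "cost1 Z c = (\<Sum>z\<leftarrow>Z. (z - c)\<^sup>2)"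

definition coords :: "real mat \<Rightarrow> nat set \<Rightarrow> nat \<Rightarrow> real multiset" where
  "coords P A j = image_mset (\<lambda>p. p $ j) (points P A)"

definition windows :: "nat \<Rightarrow> 'a list \<Rightarrow> 'a list list" where
  "windows n xs = map (\<lambda>l. take n (drop l xs)) [0..<Suc (length xs - n)]"

text \<open>\<^const>\<open>arg_min_list\<close> returns the first minimizer.\<close>

definition best_window :: "real \<Rightarrow> real multiset \<Rightarrow> real list" where
  "best_window \<alpha> X =
     arg_min_list (\<lambda>Z. cost1 Z (mean Z))
       (windows (nat \<lceil>(1 - \<alpha>) * real (size X)\<rceil>) (sorted_list_of_multiset X))"

definition center :: "real \<Rightarrow> real mat \<Rightarrow> nat set \<Rightarrow> real vec" where
  "center \<alpha> P A = vec (dim_col P) (\<lambda>j. mean (best_window \<alpha> (coords P A j)))"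


section \<open>Programs over the reals\<close>

text \<open>A program acts on numbers of an abstract type \<open>'r\<close> only through the constructors below;
  continuations receive the results. The programs of the next section are polymorphic in \<open>'r\<close>
  without class constraints and therefore cannot operate on numbers in any other way, so
  \<open>steps\<close> counts every arithmetic operation and comparison on numbers (and the loading of
  integer constants). Control flow and bookkeeping with indices and list cells are free, in
  accordance with the measure of running time used here.\<close>

datatype arith_op = Add | Sub | Mul | Div

datatype ('r, 'a) prog =
    Return 'a
  | Const nat "'r \<Rightarrow> ('r, 'a) prog"
  | Arith arith_op 'r 'r "'r \<Rightarrow> ('r, 'a) prog"
  | Leq 'r 'r "bool \<Rightarrow> ('r, 'a) prog"

primrec bind_prog :: "('r, 'a) prog \<Rightarrow> ('a \<Rightarrow> ('r, 'b) prog) \<Rightarrow> ('r, 'b) prog" where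
  "bind_prog (Return a) f = f a"
| "bind_prog (Const n c) f = Const n (\<lambda>r. bind_prog (c r) f)"
| "bind_prog (Arith o' x y c) f = Arith o' x y (\<lambda>r. bind_prog (c r) f)"
| "bind_prog (Leq x y c) f = Leq x y (\<lambda>b. bind_prog (c b) f)"

adhoc_overloading Monad_Syntax.bind \<rightleftharpoons> bind_prog

fun eval_op :: "arith_op \<Rightarrow> real \<Rightarrow> real \<Rightarrow> real" where
  "eval_op Add x y = x + y"
| "eval_op Sub x y = x - y"
| "eval_op Mul x y = x * y"
| "eval_op Div x y = x / y"

primrec run :: "(real, 'a) prog \<Rightarrow> 'a" where
  "run (Return a) = a"
| "run (Const n c) = run (c (real n))"
| "run (Arith o' x y c) = run (c (eval_op o' x y))"
| "run (Leq x y c) = run (c (x \<le> y))"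

primrec steps :: "(real, 'a) prog \<Rightarrow> nat" where
  "steps (Return a) = 0"
| "steps (Const n c) = Suc (steps (c (real n)))"
| "steps (Arith o' x y c) = Suc (steps (c (eval_op o' x y)))"
| "steps (Leq x y c) = Suc (steps (c (x \<le> y)))"

abbreviation const :: "nat \<Rightarrow> ('r, 'r) prog" where "const n \<equiv> Const n Return"
abbreviation add :: "'r \<Rightarrow> 'r \<Rightarrow> ('r, 'r) prog" where "add x y \<equiv> Arith Add x y Return"
abbreviation sub :: "'r \<Rightarrow> 'r \<Rightarrow> ('r, 'r) prog" where "sub x y \<equiv> Arith Sub x y Return"
abbreviation mul :: "'r \<Rightarrow> 'r \<Rightarrow> ('r, 'r) prog" where "mul x y \<equiv> Arith Mul x y Return"
abbreviation quot :: "'r \<Rightarrow> 'r \<Rightarrow> ('r, 'r) prog" where "quot x y \<equiv> Arith Div x y Return"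
abbreviation leq :: "'r \<Rightarrow> 'r \<Rightarrow> ('r, bool) prog" where "leq x y \<equiv> Leq x y Return"

primrec traverse :: "('a \<Rightarrow> ('r, 'b) prog) \<Rightarrow> 'a list \<Rightarrow> ('r, 'b list) prog" where
  "traverse f [] = Return []"
| "traverse f (x # xs) = do {
     y \<leftarrow> f x;
     ys \<leftarrow> traverse f xs;
     Return (y # ys)
   }"


section \<open>The algorithm as a program\<close>

fun merge :: "'r list \<Rightarrow> 'r list \<Rightarrow> ('r, 'r list) prog" where
  "merge [] ys = Return ys"
| "merge xs [] = Return xs"
| "merge (x # xs) (y # ys) = do {
     b \<leftarrow> leq x y;
     if b then do { zs \<leftarrow> merge xs (y # ys); Return (x # zs) }
     else do { zs \<leftarrow> merge (x # xs) ys; Return (y # zs) }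
   }"

fun msort :: "'r list \<Rightarrow> ('r, 'r list) prog" where
  "msort xs =
     (if length xs \<le> 1 then Return xs
      else do {
        ys \<leftarrow> msort (take (length xs div 2) xs);
        zs \<leftarrow> msort (drop (length xs div 2) xs);
        merge ys zs
      })"

declare msort.simps [simp del]

text \<open>The first element of \<open>ns\<close> that is at least \<open>x\<close>. This computes a ceiling without a
  rounding primitive.\<close>

fun first_ge :: "'r \<Rightarrow> nat list \<Rightarrow> ('r, nat) prog" where
  "first_ge x [] = Return 0"
| "first_ge x (n # ns) = do {
     r \<leftarrow> const n;
     b \<leftarrow> leq x r;
     if b then Return n else first_ge x ns
   }"

definition window_length :: "'r \<Rightarrow> nat \<Rightarrow> ('r, nat) prog" where
  "window_length \<alpha> m = do {
     one \<leftarrow> const 1;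
     \<beta> \<leftarrow> sub one \<alpha>;
     r \<leftarrow> const m;
     x \<leftarrow> mul \<beta> r;
     first_ge x [0..<Suc m]
   }"

text \<open>The sum and the sum of squares of a list.\<close>

fun sum_sq :: "'r list \<Rightarrow> ('r, 'r \<times> 'r) prog" where
  "sum_sq [] = do { z \<leftarrow> const 0; Return (z, z) }"
| "sum_sq (x # xs) = do {
     (s, q) \<leftarrow> sum_sq xs;
     s' \<leftarrow> add s x;
     x2 \<leftarrow> mul x x;
     q' \<leftarrow> add q x2;
     Return (s', q')
   }"

text \<open>The cost of a window of length \<open>n\<close> with sum \<open>s\<close> and sum of squares \<open>q\<close>, namely
  \<open>q - s\<^sup>2 / n\<close>.\<close>

definition window_cost :: "'r \<Rightarrow> 'r \<Rightarrow> 'r \<Rightarrow> ('r, 'r) prog" where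
  "window_cost n s q = do {
     s2 \<leftarrow> mul s s;
     t \<leftarrow> quot s2 n;
     sub q t
   }"

text \<open>Slides the window along the sorted list: \<open>xs\<close> starts with the next element to leave and
  \<open>ys\<close> with the next element to enter; \<open>s\<close> and \<open>q\<close> are the sums of the current window, \<open>v\<close> the
  least cost so far and \<open>b\<close> the sum of the first window attaining it. The result is the final
  \<open>b\<close>.\<close>

fun slide :: "'r \<Rightarrow> 'r list \<Rightarrow> 'r list \<Rightarrow> 'r \<Rightarrow> 'r \<Rightarrow> 'r \<Rightarrow> 'r \<Rightarrow> ('r, 'r) prog" where
  "slide n (x # xs) (y # ys) s q v b = do {
     s1 \<leftarrow> sub s x;
     s' \<leftarrow> add s1 y;
     x2 \<leftarrow> mul x x;
     y2 \<leftarrow> mul y y;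
     q1 \<leftarrow> sub q x2;
     q' \<leftarrow> add q1 y2;
     v' \<leftarrow> window_cost n s' q';
     keep \<leftarrow> leq v v';
     if keep then slide n xs ys s' q' v b
     else slide n xs ys s' q' v' s'
   }"
| "slide n _ _ s q v b = Return b"

definition coord_prog :: "nat \<Rightarrow> 'r list \<Rightarrow> ('r, 'r) prog" where
  "coord_prog n zs = do {
     xs \<leftarrow> msort zs;
     r \<leftarrow> const n;
     (s, q) \<leftarrow> sum_sq (take n xs);
     v \<leftarrow> window_cost r s q;
     b \<leftarrow> slide r xs (drop n xs) s q v s;
     quot b r
   }"

definition center_prog :: "'r \<Rightarrow> 'r mat \<Rightarrow> nat list \<Rightarrow> ('r, 'r vec) prog" where
  "center_prog \<alpha> P is = do {
     n \<leftarrow> window_length \<alpha> (length is);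
     cs \<leftarrow> traverse (\<lambda>j. coord_prog n (map (\<lambda>t. P $$ (t, j)) is)) [0..<dim_col P];
     Return (vec_of_list cs)
   }"

text \<open>The partition is given as the list of its parts, each a list of row indices.\<close>

definition kmeans_prog :: "'r \<Rightarrow> 'r mat \<Rightarrow> nat list list \<Rightarrow> ('r, 'r vec list) prog" where
  "kmeans_prog \<alpha> P parts = traverse (center_prog \<alpha> P) parts"

end

theory Submission
  imports Defs
begin

text \<open>Fix a part \<open>P\<^sub>i\<close> and a coordinate, and let \<open>S\<close> be the coordinates of \<open>P\<^sub>i \<inter> P\<^sub>i\<^sup>*\<close>. The best
  window \<open>I\<close> is optimal among all subsets of its size, because the points nearest to a given number
  are contiguous. Hence the variance of \<open>I\<close> is at most that of \<open>S\<close>. Each of \<open>I\<close> and \<open>S\<close> misses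
  at most an \<open>\<alpha>\<close>-fraction of \<open>P\<^sub>i\<close>, so both means are close to the mean of \<open>I \<inter> S\<close>, and
  the mean of \<open>S\<close> is close to the mean of \<open>P\<^sub>i\<^sup>*\<close>. The last distance is paid for by the squared
  deviation of \<open>P\<^sub>i\<^sup>*\<close> in excess of that of \<open>S\<close>, so the Cauchy-Schwarz inequality adds the two
  error terms without a cross term.\<close>

section \<open>Means and squared deviations\<close>

text \<open>Multisets rather than lists, because the argument compares sub-multisets and
  intersections, where order is irrelevant.\<close>

definition mset_mean :: "real multiset \<Rightarrow> real" where
  "mset_mean X = sum_mset X / real (size X)"

definition sq_dev :: "real multiset \<Rightarrow> real \<Rightarrow> real" where
  "sq_dev X c = (\<Sum>x\<in>#X. (x - c)\<^sup>2)"

abbreviation mean_dev :: "real multiset \<Rightarrow> real" where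
  "mean_dev X \<equiv> sq_dev X (mset_mean X)"

lemma sq_dev_empty [simp]: "sq_dev {#} c = 0"
  and sq_dev_add_mset [simp]: "sq_dev (add_mset x X) c = (x - c)\<^sup>2 + sq_dev X c"
  and sq_dev_union [simp]: "sq_dev (X + Y) c = sq_dev X c + sq_dev Y c"
  by (simp_all add: sq_dev_def)

lemma sq_dev_nonneg: "0 \<le> sq_dev X c"
  unfolding sq_dev_def by (induction X) auto

text \<open>Covers the empty multiset too: there division by zero gives mean 0. The identities built
  on it therefore need no nonemptiness condition.\<close>

lemma size_times_mset_mean: "real (size X) * mset_mean X = sum_mset X"
  unfolding mset_mean_def by (cases "X = {#}") (simp, metis nonzero_mult_div_cancel_left
      of_nat_eq_0_iff size_eq_0_iff_empty times_divide_eq_right)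

lemma sq_dev_expand:
  "sq_dev X c = (\<Sum>x\<in>#X. x\<^sup>2) - 2 * c * sum_mset X + real (size X) * c\<^sup>2"
  by (induction X) (simp_all add: power2_eq_square algebra_simps)

text \<open>Parallel axis identity: deviations from the mean sum to zero, so expanding around it
  leaves no cross term.\<close>

lemma sq_dev_eq_mean_dev:
  "sq_dev X c = mean_dev X + real (size X) * (mset_mean X - c)\<^sup>2"
  unfolding sq_dev_expand size_times_mset_mean[symmetric]
  by (simp add: power2_eq_square algebra_simps)

lemma mean_dev_le_sq_dev: "mean_dev X \<le> sq_dev X c"
  by (simp add: sq_dev_eq_mean_dev[of X c])

lemma mean_dev_mono: "J \<subseteq># X \<Longrightarrow> mean_dev J \<le> mean_dev X"
  using mean_dev_le_sq_dev[of J "mset_mean X"]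
  by (auto simp: mset_subset_eq_exists_conv intro!: add_increasing2 sq_dev_nonneg)

text \<open>The mean of \<open>X\<close> is the weighted mean of \<open>J\<close> and the rest
  \<open>R\<close>, so their two displacements balance like a lever. A far displacement of
  \<open>J\<close> forces a large deviation of \<open>X\<close> in excess of that of
  \<open>J\<close>; the inner deviation of \<open>R\<close> is dropped.\<close>

lemma submset_mean_distance:
  assumes "J \<subseteq># X"
  shows "real (size J) * real (size X) * (mset_mean J - mset_mean X)\<^sup>2
    \<le> (real (size X) - real (size J)) * (mean_dev X - mean_dev J)"
proof -
  obtain R where X: "X = J + R" using assms by (auto simp: mset_subset_eq_exists_conv)
  define r t where "r = real (size J)" and "t = real (size R)"
  define \<delta> \<epsilon> where "\<delta> = mset_mean J - mset_mean X" and "\<epsilon> = mset_mean R - mset_mean X"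
  have "(r + t) * mset_mean X = r * mset_mean J + t * mset_mean R"
    using size_times_mset_mean[of X] size_times_mset_mean[of J] size_times_mset_mean[of R]
    by (simp add: X r_def t_def)
  then have balance: "t * \<epsilon> = - (r * \<delta>)"
    by (simp add: \<delta>_def \<epsilon>_def algebra_simps)
  have "mean_dev X = mean_dev J + r * \<delta>\<^sup>2 + mean_dev R + t * \<epsilon>\<^sup>2"
    using sq_dev_eq_mean_dev[of J "mset_mean X"] sq_dev_eq_mean_dev[of R "mset_mean X"]
    by (simp add: r_def t_def \<delta>_def \<epsilon>_def) (simp add: X)
  \<comment> \<open>Multiplying by \<open>t\<close> produces
    \<open>(t * \<epsilon>)\<^sup>2\<close>, which \<open>balance\<close> rewrites without dividing
    by \<open>t\<close>; \<open>t\<close> is 0 when \<open>J = X\<close>.\<close>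
  then have "t * (mean_dev X - mean_dev J) = t * mean_dev R + t * r * \<delta>\<^sup>2 + (t * \<epsilon>)\<^sup>2"
    by (simp add: power2_eq_square algebra_simps)
  also have "\<dots> = t * mean_dev R + r * (r + t) * \<delta>\<^sup>2"
    unfolding balance by (simp add: power2_eq_square algebra_simps)
  also have "\<dots> \<ge> r * (r + t) * \<delta>\<^sup>2"
    by (simp add: t_def sq_dev_nonneg)
  finally show ?thesis by (simp add: X r_def t_def \<delta>_def)
qed


section \<open>Optimality of contiguous windows\<close>

lemma set_windows:
  "set (windows n xs) = {take n (drop l xs) | l. l \<le> length xs - n}"
  by (auto simp: windows_def simp del: upt_Suc)

lemma mset_window_subset: "W \<in> set (windows n xs) \<Longrightarrow> mset W \<subseteq># mset xs"
  unfolding set_windows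
  by (auto, metis append_take_drop_id mset_append mset_subset_eq_add_left
      mset_subset_eq_add_right subset_mset.order_trans)

lemma length_window: "W \<in> set (windows n xs) \<Longrightarrow> n \<le> length xs \<Longrightarrow> length W = n"
  unfolding set_windows by auto

lemma windows_neq_Nil [simp]: "windows n xs \<noteq> []"
  by (simp add: windows_def)

text \<open>Start positions shift by one. Strictness of \<open>n < length xs\<close> ensures that
  the tail still has full windows of length \<open>n\<close>.\<close>

lemma windows_tl: "n < length xs \<Longrightarrow> W \<in> set (windows n (tl xs)) \<Longrightarrow> W \<in> set (windows n xs)"
  unfolding set_windows by (cases xs) (force intro: exI[where x = "Suc l" for l])+

lemma windows_butlast:
  assumes "n < length xs" "W \<in> set (windows n (butlast xs))"
  shows "W \<in> set (windows n xs)"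
proof -
  obtain l where "W = take n (drop l (butlast xs))" "l \<le> length xs - 1 - n"
    using assms by (auto simp: set_windows)
  then show ?thesis using assms(1) unfolding set_windows
    by (auto simp: butlast_conv_take drop_take min_def intro!: exI[of _ l])
qed

text \<open>Discarding a point farthest from \<open>c\<close> never raises the average squared
  distance to \<open>c\<close>; repeat until \<open>n\<close> points remain. It serves to cut the
  correctly labelled points down to the window length.\<close>

lemma exists_submset_below_average:
  assumes "n \<le> size S"
  shows "\<exists>Z. Z \<subseteq># S \<and> size Z = n \<and> real (size S) * sq_dev Z c \<le> real n * sq_dev S c"
  using assms
proof (induction "size S" arbitrary: S)
  case 0
  then show ?case by auto
next
  case (Suc s)
  show ?case
  proof (cases "n = Suc s")
    case True
    then show ?thesis using Suc by (intro exI[of _ S]) auto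
  next
    case False
    define f where "f = (\<lambda>x. (x - c)\<^sup>2)"
    have "Max (f ` set_mset S) \<in> f ` set_mset S" using Suc by (intro Max_in) auto
    then obtain e where e: "e \<in># S" "f e = Max (f ` set_mset S)" by auto
    obtain T where S: "S = add_mset e T" using e(1) by (metis insert_DiffM)
    have far: "f x \<le> f e" if "x \<in># S" for x unfolding e(2) using that by auto
    have "sq_dev T c \<le> real (size T) * f e"
      using sum_mset_mono[of T f "\<lambda>_. f e"] far S by (simp add: sq_dev_def f_def)
    moreover obtain Z where Z: "Z \<subseteq># T" "size Z = n"
      "real (size T) * sq_dev Z c \<le> real n * sq_dev T c"
      using Suc.hyps(1)[of T] Suc False S by auto
    moreover have "sq_dev Z c \<le> real n * f e"
      using sum_mset_mono[of Z f "\<lambda>_. f e"] far S Z mset_subset_eqD[OF Z(1)]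
      by (simp add: sq_dev_def f_def)
    \<comment> \<open>Since \<open>size S = size T + 1\<close>, this is the bound for
      \<open>T\<close> plus \<open>sq_dev Z c \<le> real n * f e\<close>.\<close>
    ultimately have "real (size S) * sq_dev Z c \<le> real n * sq_dev S c"
      by (simp add: S f_def algebra_simps)
    moreover have "Z \<subseteq># S" using Z(1) S by (simp add: subset_mset.trans[of Z T])
    ultimately show ?thesis using Z by blast
  qed
qed

text \<open>A point farthest from \<open>c\<close> is the first or the last of the sorted list; discarding it leaves
  shorter lists whose windows are windows of \<open>xs\<close>.\<close>

lemma exists_window_le_submset:
  assumes "sorted xs" "Z \<subseteq># mset xs"
  shows "\<exists>W\<in>set (windows (size Z) xs). sq_dev (mset W) c \<le> sq_dev Z c"
  using assms
proof (induction "length xs" arbitrary: xs Z)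
  case 0
  then show ?case by (auto simp: set_windows)
next
  case (Suc k)
  define n where "n = size Z"
  have n_le: "n \<le> length xs"
    using size_mset_mono[OF Suc.prems(2)] by (simp add: n_def)
  show ?case
  proof (cases "n = length xs")
    case True
    then have "Z = mset xs"
      using Suc.prems(2) by (metis n_def size_mset subset_mset.le_less mset_subset_size
          nat_neq_iff)
    then show ?thesis by (auto simp: set_windows intro!: exI[of _ 0])
  next
    case False
    then have n_less: "n < length xs" using n_le by simp
    have ne: "xs \<noteq> []" using Suc.hyps(2) by auto
    have ends: "hd xs \<le> x" "x \<le> last xs" if "x \<in> set xs" for x
      using that Suc.prems(1) ne
       apply (metis list.collapse set_ConsD sorted_simps(2) order_refl)
      using that Suc.prems(1) ne
      by (metis in_set_conv_nth last_conv_nth length_greater_0_conv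
          nat_less_le less_Suc_eq_le sorted_nth_mono diff_less less_one Suc_pred')
    obtain e ys where xs: "mset xs = add_mset e (mset ys)" and "sorted ys" and len: "length ys = k"
      and far: "\<And>x. x \<in> set xs \<Longrightarrow> (x - c)\<^sup>2 \<le> (e - c)\<^sup>2"
      and win: "set (windows n ys) \<subseteq> set (windows n xs)"
    proof (cases "\<bar>hd xs - c\<bar> \<le> \<bar>last xs - c\<bar>")
      case True
      show thesis
      proof (rule that[of "last xs" "butlast xs"])
        show "mset xs = add_mset (last xs) (mset (butlast xs))"
          using ne by (metis append_butlast_last_id mset_append mset_single_iff_right
              add_mset_add_single mset.simps)
        show "sorted (butlast xs)" using Suc.prems(1) by (simp add: sorted_butlast)
        show "(x - c)\<^sup>2 \<le> (last xs - c)\<^sup>2" if "x \<in> set xs" for x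
          using ends[OF that] True by (subst abs_le_square_iff[symmetric]) linarith
        show "set (windows n (butlast xs)) \<subseteq> set (windows n xs)"
          using windows_butlast[OF n_less] by blast
      qed (use Suc.hyps(2) in auto)
    next
      case False
      show thesis
      proof (rule that[of "hd xs" "tl xs"])
        show "mset xs = add_mset (hd xs) (mset (tl xs))"
          using ne by (cases xs) auto
        show "sorted (tl xs)" using Suc.prems(1) by (simp add: sorted_tl)
        show "(x - c)\<^sup>2 \<le> (hd xs - c)\<^sup>2" if "x \<in> set xs" for x
          using ends[OF that] False by (subst abs_le_square_iff[symmetric]) linarith
        show "set (windows n (tl xs)) \<subseteq> set (windows n xs)"
          using windows_tl[OF n_less] by blast
      qed (use Suc.hyps(2) in auto)
    qed
    obtain Z' where Z': "Z' \<subseteq># mset ys" "size Z' = n" "sq_dev Z' c \<le> sq_dev Z c"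
    proof (cases "e \<in># Z")
      case True
      then obtain T where Z: "Z = add_mset e T" by (metis insert_DiffM)
      then have T: "T \<subseteq># mset ys" using Suc.prems(2) xs by simp
      moreover have "T \<noteq> mset ys" using n_less n_def Z len Suc.hyps(2) by auto
      ultimately obtain R where R: "mset ys = T + R" "R \<noteq> {#}"
        by (auto simp: mset_subset_eq_exists_conv)
      then obtain y R' where "R = add_mset y R'" by (metis multiset_cases)
      then have y: "add_mset y T \<subseteq># mset ys" and "y \<in># mset ys" using R by auto
      then have "y \<in> set xs" using xs by (metis set_mset_mset insert_iff set_mset_add_mset_insert)
      then show thesis using that[of "add_mset y T"] y Z far n_def by auto
    next
      case False
      then have "Z \<subseteq># mset ys" using Suc.prems(2) xs
        by (metis diff_single_trivial subset_eq_diff_conv add_mset_add_single)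
      then show thesis using that[of Z] n_def by auto
    qed
    then show ?thesis
      using Suc.hyps(1)[of ys Z'] \<open>sorted ys\<close> len win Suc.hyps(2)
      unfolding n_def by (metis order_trans subsetD)
  qed
qed


section \<open>The center of one coordinate\<close>

lemma cost1_eq_sq_dev: "cost1 Z c = sq_dev (mset Z) c"
  unfolding cost1_def sq_dev_def by (metis mset_map sum_mset_sum_list)

lemma mean_eq_mset_mean: "mean Z = mset_mean (mset Z)"
  by (simp add: mean_def mset_mean_def sum_mset_sum_list)

text \<open>Links the cost in the specification of the window to the formula that
  \<open>window_cost\<close> evaluates from running sums.\<close>

lemma cost1_mean: "Z \<noteq> [] \<Longrightarrow> cost1 Z (mean Z) = (\<Sum>z\<leftarrow>Z. z\<^sup>2) - (sum_list Z)\<^sup>2 / real (length Z)"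
proof -
  assume "Z \<noteq> []"
  have "(\<Sum>x\<in>#mset Z. x\<^sup>2) = (\<Sum>z\<leftarrow>Z. z\<^sup>2)" by (metis mset_map sum_mset_sum_list)
  then show ?thesis using \<open>Z \<noteq> []\<close>
    by (simp add: cost1_eq_sq_dev sq_dev_expand mean_def sum_mset_sum_list)
      (simp add: field_simps power2_eq_square)
qed

text \<open>Turns the recursion from the right into the left-to-right scan performed by
  \<open>slide\<close>; on a tie the earlier element survives.\<close>

lemma arg_min_list_Cons2:
  "arg_min_list f (x # y # zs) = arg_min_list f ((if f x \<le> f y then x else y) # zs)"
  by (cases zs) (auto simp: Let_def)

text \<open>Cauchy-Schwarz for two summands: the cross term satisfies
  \<open>2 * (x * y) \<le> a * B + b * A\<close> by the inequality of arithmetic and geometric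
  means.\<close>

lemma sq_add_le_of_sq_le:
  fixes x y A B a b :: real
  assumes "x\<^sup>2 \<le> a * A" "y\<^sup>2 \<le> b * B" "0 \<le> a" "0 \<le> b" "0 \<le> A" "0 \<le> B"
  shows "(x + y)\<^sup>2 \<le> (a + b) * (A + B)"
proof -
  have "4 * (x\<^sup>2 * y\<^sup>2) \<le> 4 * ((a * A) * (b * B))"
    using assms by (intro mult_left_mono mult_mono) simp_all
  also have "\<dots> \<le> (a * B + b * A)\<^sup>2"
    using zero_le_power2[of "a * B - b * A"] by (simp add: power2_eq_square algebra_simps)
  finally have "(2 * (x * y))\<^sup>2 \<le> (a * B + b * A)\<^sup>2"
    by (simp add: power_mult_distrib)
  moreover have "0 \<le> a * B + b * A" using assms by simp
  ultimately have "2 * (x * y) \<le> a * B + b * A" by (rule power2_le_imp_le)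
  then show ?thesis using assms(1,2) by (simp add: power2_eq_square algebra_simps)
qed

text \<open>Here \<open>Y\<close> stands for one coordinate of the predicted part, \<open>X\<close>
  for that of the optimal part and \<open>S\<close> for that of their intersection. The term
  \<open>a\<close> pays for the distance between the means of \<open>S\<close> and \<open>X\<close>,
  and \<open>b\<close> for that between the window and \<open>S\<close>.\<close>

lemma best_window_error:
  fixes X Y S :: "real multiset" and \<alpha> :: real
  defines "a \<equiv> \<alpha> / (1 - \<alpha>)" and "b \<equiv> 4 * \<alpha> / ((1 - 2 * \<alpha>) * (1 - \<alpha>))"
  assumes \<alpha>: "0 \<le> \<alpha>" "\<alpha> < 1 / 2"
    and S: "S \<subseteq># X" "S \<subseteq># Y" "Y \<noteq> {#}"
    and sizeX: "(1 - \<alpha>) * real (size X) \<le> real (size S)"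
    and sizeY: "(1 - \<alpha>) * real (size Y) \<le> real (size S)"
  shows "sq_dev X (mean (best_window \<alpha> Y)) \<le> (1 + (a + b)) * mean_dev X"
proof -
  define n where "n = nat \<lceil>(1 - \<alpha>) * real (size Y)\<rceil>"
  define xs where "xs = sorted_list_of_multiset Y"
  define I where "I = mset (best_window \<alpha> Y)"
  have "0 < (1 - \<alpha>) * real (size Y)" using \<alpha> S by (simp add: nonempty_has_size)
  then have n_pos: "0 < n" and n_ge: "(1 - \<alpha>) * real (size Y) \<le> real n"
    unfolding n_def by linarith+
  \<comment> \<open>\<open>size S\<close> is an integer above
    \<open>(1 - \<alpha>) * real (size Y)\<close>, hence also above its ceiling.\<close>
  have n_le: "n \<le> size S" unfolding n_def using sizeY by linarith
  have le_Y: "size S \<le> size Y" using S by (simp add: size_mset_mono)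
  have xs: "sorted xs" "mset xs = Y" "length xs = size Y"
    unfolding xs_def by (simp_all add: sorted_sorted_list_of_multiset) (metis mset_sorted_list_of_multiset size_mset)
  have best: "best_window \<alpha> Y = arg_min_list (\<lambda>Z. cost1 Z (mean Z)) (windows n xs)"
    by (simp add: best_window_def n_def xs_def)
  have best_in: "best_window \<alpha> Y \<in> set (windows n xs)"
    unfolding best by (rule arg_min_list_in) simp
  have best_le: "mean_dev I \<le> mean_dev (mset W)" if "W \<in> set (windows n xs)" for W
    using that f_arg_min_list_f[of "windows n xs" "\<lambda>Z. cost1 Z (mean Z)"]
    by (simp add: I_def best cost1_eq_sq_dev mean_eq_mset_mean)
  have I: "I \<subseteq># Y" "size I = n"
    using mset_window_subset[OF best_in] length_window[OF best_in] xs n_le le_Y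
    by (auto simp: I_def)
  define s r m M where "s = real (size S)" and "r = real (size (I \<inter># S))"
    and "m = real (size Y)" and "M = real (size X)"
  \<comment> \<open>The variance of \<open>S\<close> is the common scale for all distances between
    means below.\<close>
  define v where "v = mean_dev S / s"
  have s_pos: "0 < s" and m_pos: "0 < m" using n_pos n_le le_Y by (auto simp: s_def m_def)
  have V: "mean_dev S = s * v" and v_nonneg: "0 \<le> v"
    using s_pos by (simp_all add: v_def sq_dev_nonneg)
  \<comment> \<open>The comparison runs through the fixed center \<open>mset_mean S\<close>: some
    \<open>n\<close> points \<open>Z\<close> of \<open>S\<close> have average squared distance at
    most \<open>v\<close> to it, some window does at least as well as \<open>Z\<close>, and
    \<open>I\<close> has least deviation among windows.\<close>
  have VI: "mean_dev I \<le> real n * v"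
  proof -
    obtain Z where Z: "Z \<subseteq># S" "size Z = n" "s * sq_dev Z (mset_mean S) \<le> real n * mean_dev S"
      using exists_submset_below_average[OF n_le, of "mset_mean S"] by (auto simp: s_def)
    obtain W where W: "W \<in> set (windows n xs)" "sq_dev (mset W) (mset_mean S) \<le> sq_dev Z (mset_mean S)"
      using exists_window_le_submset[of xs Z "mset_mean S"] xs Z S(2)
      by (auto intro: subset_mset.trans)
    have "mean_dev I \<le> sq_dev Z (mset_mean S)"
      using best_le[OF W(1)] mean_dev_le_sq_dev[of "mset W" "mset_mean S"] W(2) by linarith
    also have "\<dots> \<le> real n * v"
      using Z(3) s_pos by (simp add: v_def field_simps)
    finally show ?thesis .
  qed
  \<comment> \<open>Inclusion-exclusion inside \<open>Y\<close> forces \<open>I\<close> and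
    \<open>S\<close> to overlap in at least \<open>n + s - m\<close> points.\<close>
  have "size (I \<union># S) + size (I \<inter># S) = n + size S"
    using size_Un_Int[of I S] I(2) by simp
  moreover have "size (I \<union># S) \<le> size Y"
    using I(1) S(2) by (intro size_mset_mono) simp
  ultimately have r_ge: "real n + s - m \<le> r" by (simp add: r_def s_def m_def)
  have r_low: "(1 - 2 * \<alpha>) * m \<le> r"
    using r_ge n_ge sizeY by (simp add: s_def m_def algebra_simps)
  then have r_pos: "0 < r"
    using \<alpha> m_pos by (elim less_le_trans[rotated]) simp
  \<comment> \<open>Passing from \<open>I\<close> or \<open>S\<close> to the overlap loses at most
    \<open>\<alpha> * m\<close> points; \<open>\<beta>\<close> bounds this loss relative to the
    overlap, whose size is at least \<open>(1 - 2 * \<alpha>) * m\<close>.\<close>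
  define \<beta> where "\<beta> = \<alpha> / (1 - 2 * \<alpha>)"
  have \<beta>: "0 \<le> \<beta>" using \<alpha> by (simp add: \<beta>_def)
  have \<beta>r: "\<alpha> * m \<le> \<beta> * r"
    using mult_left_mono[OF r_low \<beta>] \<alpha> by (simp add: \<beta>_def)
  have close: "(mset_mean J - mset_mean Z)\<^sup>2 \<le> \<beta> * v"
    if "J \<subseteq># Z" "real (size J) = r" "real (size Z) - r \<le> \<alpha> * m" "mean_dev Z \<le> real (size Z) * v"
      "size Z > 0" for J Z
  proof -
    have "r * real (size Z) * (mset_mean J - mset_mean Z)\<^sup>2
        \<le> (real (size Z) - r) * (mean_dev Z - mean_dev J)"
      using submset_mean_distance[OF that(1)] that(2) by simp
    also have "\<dots> \<le> (\<beta> * r) * (real (size Z) * v)"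
      using that \<beta>r sq_dev_nonneg[of J] mean_dev_mono[OF that(1)] size_mset_mono[OF that(1)] \<beta> r_pos v_nonneg
      by (intro mult_mono) (auto simp: field_simps intro: order.trans)
    finally have "(r * real (size Z)) * (mset_mean J - mset_mean Z)\<^sup>2 \<le> (r * real (size Z)) * (\<beta> * v)"
      by (simp add: mult_ac)
    then show ?thesis using r_pos that(5) by (simp add: mult_le_cancel_left_pos)
  qed
  have cI: "(mset_mean (I \<inter># S) - mset_mean I)\<^sup>2 \<le> \<beta> * v"
    using r_ge sizeY VI n_pos
    by (intro close) (simp_all add: I r_def m_def s_def algebra_simps)
  have cS: "(mset_mean (I \<inter># S) - mset_mean S)\<^sup>2 \<le> \<beta> * v"
    using r_ge n_ge V n_pos n_le
    by (intro close) (simp_all add: r_def m_def s_def algebra_simps)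
  \<comment> \<open>Two distances, each at most the square root of \<open>\<beta> * v\<close>: their
    sum, squared, yields the factor 4 in \<open>b\<close>.\<close>
  have IS: "(mset_mean I - mset_mean S)\<^sup>2 \<le> 4 * \<beta> * v"
    using sq_add_le_of_sq_le[of "mset_mean I - mset_mean (I \<inter># S)" \<beta> v
        "mset_mean (I \<inter># S) - mset_mean S" \<beta> v] cI cS \<beta> v_nonneg
    by (simp add: power2_commute)
  have b_eq: "4 * \<beta> = b * (1 - \<alpha>)"
    using \<alpha> by (simp add: b_def \<beta>_def)
  have ab: "0 \<le> a" "0 \<le> b" using \<alpha> by (simp_all add: a_def b_def)
  have Ms: "s \<le> M" using size_mset_mono[OF S(1)] by (simp add: s_def M_def)
  have M_pos: "0 < M" using Ms s_pos by simp
  \<comment> \<open>The factor \<open>1 - \<alpha>\<close> split off from \<open>4 * \<beta>\<close>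
    is spent on replacing the weight \<open>M\<close> by \<open>s\<close>.\<close>
  have "M * (mset_mean I - mset_mean S)\<^sup>2 \<le> M * (b * (1 - \<alpha>) * v)"
    using IS M_pos b_eq by simp
  also have "\<dots> = b * v * ((1 - \<alpha>) * M)" by simp
  also have "\<dots> \<le> b * v * s"
    using sizeX ab v_nonneg by (intro mult_left_mono) (simp_all add: M_def s_def)
  finally have eI: "M * (mset_mean I - mset_mean S)\<^sup>2 \<le> b * mean_dev S"
    using V by (simp add: mult_ac)
  have aS: "M - s \<le> a * s"
  proof -
    have "\<alpha> * ((1 - \<alpha>) * M) \<le> \<alpha> * s" using sizeX \<alpha> by (simp add: mult_left_mono M_def s_def)
    moreover have "(1 - \<alpha>) * (M - s) = (1 - \<alpha>) * M - s + \<alpha> * s" by (simp add: algebra_simps)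
    ultimately have "(1 - \<alpha>) * (M - s) \<le> \<alpha> * s" using sizeX by (simp add: M_def s_def)
    then show ?thesis using \<alpha> by (simp add: a_def field_simps)
  qed
  have dev: "s * M * (mset_mean S - mset_mean X)\<^sup>2 \<le> (M - s) * (mean_dev X - mean_dev S)"
    using submset_mean_distance[OF S(1)] by (simp add: M_def s_def)
  have gap: "0 \<le> mean_dev X - mean_dev S"
    using mean_dev_mono[OF S(1)] by simp
  have "s * (M * (mset_mean S - mset_mean X)\<^sup>2) \<le> s * (a * (mean_dev X - mean_dev S))"
    using dev mult_right_mono[OF aS gap] by (simp add: mult_ac)
  then have eX: "M * (mset_mean S - mset_mean X)\<^sup>2 \<le> a * (mean_dev X - mean_dev S)"
    using s_pos by (simp add: mult_le_cancel_left_pos)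
  \<comment> \<open>The distances draw on disjoint budgets, \<open>mean_dev X - mean_dev S\<close>
    and \<open>mean_dev S\<close>, which add up to \<open>mean_dev X\<close>. The factor
    \<open>sqrt M\<close> turns the weighted squared distances into plain squares.\<close>
  have "(sqrt M * (mset_mean S - mset_mean X) + sqrt M * (mset_mean I - mset_mean S))\<^sup>2
      \<le> (a + b) * ((mean_dev X - mean_dev S) + mean_dev S)"
    using eX eI ab gap M_pos sq_dev_nonneg
    by (intro sq_add_le_of_sq_le) (simp_all add: power_mult_distrib)
  then have "M * (mset_mean I - mset_mean X)\<^sup>2 \<le> (a + b) * mean_dev X"
    using M_pos by (simp add: distrib_left[symmetric] power_mult_distrib)
  then show ?thesis
    using sq_dev_eq_mean_dev[of X "mset_mean I"]
    by (simp add: mean_eq_mset_mean I_def M_def power2_commute algebra_simps)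
qed


section \<open>Cost of the returned centers\<close>

text \<open>The program stores parts as index lists, the specification as sets; distinctness makes
  the multiplicities agree.\<close>

lemma coords_eq_mset:
  assumes "distinct A" "set A \<subseteq> {..<dim_row P}" "j < dim_col P"
  shows "coords P (set A) j = mset (map (\<lambda>t. P $$ (t, j)) A)"
  using assms unfolding coords_def points_def
  by (auto simp: mset_set_set[symmetric] multiset.map_comp subset_iff intro!: image_mset_cong)

lemma cost_points: "cost (points P A) C = (\<Sum>t\<in>A. Min (sq_dist (row P t) ` C))"
  by (simp add: cost_def points_def multiset.map_comp comp_def sum_unfold_sum_mset)

text \<open>Squared Euclidean distance is a sum over coordinates; exchanging the sums reduces the
  problem to dimension one.\<close>

lemma cost_points_single:
  assumes "finite A"
  shows "cost (points P A) {c} = (\<Sum>j<dim_col P. sq_dev (coords P A j) (c $ j))"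
proof -
  have "cost (points P A) {c} = (\<Sum>t\<in>A. sq_dist (row P t) c)"
    by (simp add: cost_points)
  also have "\<dots> = (\<Sum>j<dim_col P. \<Sum>t\<in>A. (row P t $ j - c $ j)\<^sup>2)"
    unfolding sq_dist_def by (simp add: sum.swap[of _ _ A])
  also have "\<dots> = (\<Sum>j<dim_col P. sq_dev (coords P A j) (c $ j))"
    by (simp add: coords_def points_def sq_dev_def multiset.map_comp comp_def sum_unfold_sum_mset)
  finally show ?thesis .
qed

lemma size_coords: "size (coords P A j) = card A"
  by (simp add: coords_def points_def)

lemma coords_mono: "finite B \<Longrightarrow> A \<subseteq> B \<Longrightarrow> coords P A j \<subseteq># coords P B j"
  unfolding coords_def points_def
  by (intro image_mset_subseteq_mono) (simp add: finite_subset msubset_mset_set_iff)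

text \<open>The one-dimensional bound is against the mean in each coordinate, and the mean is the
  best center. Hence \<open>c\<close> may be arbitrary, in particular the given optimal
  center.\<close>

lemma center_cost:
  fixes P :: "real mat" and Q Q' :: "nat set"
  assumes \<alpha>: "0 \<le> \<alpha>" "\<alpha> < 1 / 2" and fin: "finite Q" "finite Q'" "Q \<noteq> {}"
    and overlap: "(1 - \<alpha>) * real (max (card Q) (card Q')) \<le> real (card (Q \<inter> Q'))"
  shows "cost (points P Q') {center \<alpha> P Q}
    \<le> (1 + (\<alpha> / (1 - \<alpha>) + 4 * \<alpha> / ((1 - 2 * \<alpha>) * (1 - \<alpha>)))) * cost (points P Q') {c}"
proof -
  define K where "K = \<alpha> / (1 - \<alpha>) + 4 * \<alpha> / ((1 - 2 * \<alpha>) * (1 - \<alpha>))"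
  have K: "0 \<le> K" using \<alpha> by (simp add: K_def)
  have size: "(1 - \<alpha>) * real (card Q) \<le> real (card (Q \<inter> Q'))"
    "(1 - \<alpha>) * real (card Q') \<le> real (card (Q \<inter> Q'))"
    using \<alpha> by (auto intro!: order_trans[OF _ overlap] mult_left_mono)
  have "cost (points P Q') {center \<alpha> P Q}
      = (\<Sum>j<dim_col P. sq_dev (coords P Q' j) (mean (best_window \<alpha> (coords P Q j))))"
    using fin by (simp add: cost_points_single center_def)
  also have "\<dots> \<le> (\<Sum>j<dim_col P. (1 + K) * mean_dev (coords P Q' j))"
    unfolding K_def
  proof (intro sum_mono best_window_error \<alpha>)
    fix j
    show "coords P (Q \<inter> Q') j \<subseteq># coords P Q' j" "coords P (Q \<inter> Q') j \<subseteq># coords P Q j"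
      using fin by (simp_all add: coords_mono)
    show "coords P Q j \<noteq> {#}"
      using fin size_coords[of P Q j] by (metis card_eq_0_iff size_empty)
  qed (simp_all add: size_coords size)
  also have "\<dots> \<le> (\<Sum>j<dim_col P. (1 + K) * sq_dev (coords P Q' j) (c $ j))"
    using K by (intro sum_mono mult_left_mono mean_dev_le_sq_dev) auto
  also have "\<dots> = (1 + K) * cost (points P Q') {c}"
    using fin by (simp add: cost_points_single sum_distrib_left)
  finally show ?thesis unfolding K_def .
qed

text \<open>Applied to the optimal partition: the returned centers come from the predicted parts but
  are charged with the optimal ones.\<close>

lemma cost_le_assignment:
  assumes "indexed_partition k A Q" "finite A" "finite C" "\<And>i. i < k \<Longrightarrow> c i \<in> C"
  shows "cost (points P A) C \<le> (\<Sum>i<k. cost (points P (Q i)) {c i})"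
proof -
  have fin: "finite (Q i)" if "i < k" for i
    using that assms(1,2) by (auto simp: indexed_partition_def intro: finite_subset)
  have A: "A = (\<Union>i<k. Q i)" and disj: "disjoint_family_on Q {..<k}"
    using assms(1) by (auto simp: indexed_partition_def)
  have "cost (points P A) C = (\<Sum>i<k. cost (points P (Q i)) C)"
    unfolding cost_points A using fin disj
    by (intro sum.UNION_disjoint) (auto simp: disjoint_family_on_def)
  also have "\<dots> \<le> (\<Sum>i<k. cost (points P (Q i)) {c i})"
    unfolding cost_points using assms(3,4) by (intro sum_mono) auto
  finally show ?thesis .
qed

lemma centers_cost:
  assumes \<alpha>: "0 \<le> \<alpha>" "\<alpha> < 1 / 2" and err: "has_label_error_rate k P Q \<alpha>"
  shows "cost (points P {..<dim_row P}) ((\<lambda>i. center \<alpha> P (Q i)) ` {..<k})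
    \<le> (1 + (\<alpha> / (1 - \<alpha>) + 4 * \<alpha> / ((1 - 2 * \<alpha>) * (1 - \<alpha>)))) * OPT k P"
proof -
  let ?K = "1 + (\<alpha> / (1 - \<alpha>) + 4 * \<alpha> / ((1 - 2 * \<alpha>) * (1 - \<alpha>)))"
  obtain Q' c' where Q: "indexed_partition k {..<dim_row P} Q" "\<And>i. i < k \<Longrightarrow> Q i \<noteq> {}"
    and Q': "indexed_partition k {..<dim_row P} Q'"
    and opt: "(\<Sum>i<k. cost (points P (Q' i)) {c' i}) = OPT k P"
    and overlap: "\<And>i. i < k \<Longrightarrow>
      (1 - \<alpha>) * real (max (card (Q i)) (card (Q' i))) \<le> real (card (Q i \<inter> Q' i))"
    using err unfolding has_label_error_rate_def by blast
  have fin: "finite (Q i)" "finite (Q' i)" if "i < k" for i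
    using that Q(1) Q' unfolding indexed_partition_def
    by (metis UN_upper finite_lessThan finite_subset lessThan_iff)+
  have "cost (points P {..<dim_row P}) ((\<lambda>i. center \<alpha> P (Q i)) ` {..<k})
      \<le> (\<Sum>i<k. cost (points P (Q' i)) {center \<alpha> P (Q i)})"
    using Q' by (rule cost_le_assignment) auto
  also have "\<dots> \<le> (\<Sum>i<k. ?K * cost (points P (Q' i)) {c' i})"
    using \<alpha> fin Q(2) overlap by (intro sum_mono center_cost) auto
  finally show ?thesis by (simp add: opt flip: sum_distrib_left)
qed


section \<open>Correctness of the program\<close>

lemma run_bind [simp]: "run (bind_prog p f) = run (f (run p))"
  by (induction p) simp_all

lemma run_traverse [simp]: "run (traverse f xs) = map (run \<circ> f) xs"
  by (induction xs) simp_all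

lemma mset_run_merge: "mset (run (merge xs ys)) = mset xs + mset ys"
  by (induction xs ys rule: merge.induct) auto

lemma sorted_run_merge: "sorted xs \<Longrightarrow> sorted ys \<Longrightarrow> sorted (run (merge xs ys))"
proof (induction xs ys rule: merge.induct)
  case (3 x xs y ys)
  have "set (run (merge us vs)) = set us \<union> set vs" for us vs :: "real list"
    using mset_run_merge[of us vs] by (metis set_mset_mset set_mset_union)
  then show ?case using 3 by auto
qed auto

lemma run_msort: "mset (run (msort xs)) = mset xs \<and> sorted (run (msort xs))"
proof (induction xs rule: msort.induct)
  case (1 xs)
  show ?case
  proof (cases "length xs \<le> 1")
    case True
    then show ?thesis
      by (subst (1 2) msort.simps) (auto simp: le_Suc_eq length_Suc_conv)
  next
    case False
    then show ?thesis using 1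
      by (subst (1 2) msort.simps)
        (auto simp: mset_run_merge sorted_run_merge simp flip: mset_append)
  qed
qed

lemma run_msort_eq: "run (msort xs) = sort xs"
  using run_msort[of xs] by (metis sorted_list_of_multiset_mset sorted_sort_id)

text \<open>The search cannot return less than its starting point, hence the maximum. The bound
  \<open>x \<le> real b\<close> keeps it from reaching the default 0 of the empty list.\<close>

lemma run_first_ge:
  assumes "a \<le> b" "x \<le> real b"
  shows "run (first_ge x [a..<Suc b]) = max a (nat \<lceil>x\<rceil>)"
  using assms
proof (induction "b - a" arbitrary: a)
  case 0
  then show ?case by (auto simp: max_def) linarith
next
  case (Suc n)
  then have "run (first_ge x [Suc a..<Suc b]) = max (Suc a) (nat \<lceil>x\<rceil>)" by auto
  then show ?case using Suc
    by (subst upt_conv_Cons) (auto simp: max_def simp del: upt_Suc, linarith+)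
qed

lemma run_window_length:
  assumes "0 \<le> \<alpha>"
  shows "run (window_length \<alpha> m) = nat \<lceil>(1 - \<alpha>) * real m\<rceil>"
proof -
  have "(1 - \<alpha>) * real m \<le> real m" using assms by (simp add: mult_left_le_one_le algebra_simps)
  then show ?thesis by (simp add: window_length_def run_first_ge del: upt_Suc)
qed

lemma run_sum_sq: "run (sum_sq xs) = (sum_list xs, \<Sum>x\<leftarrow>xs. x\<^sup>2)"
  by (induction xs) (auto simp: power2_eq_square)

lemma run_window_cost:
  "length Z = n \<Longrightarrow> 0 < n \<Longrightarrow> run (window_cost (real n) (sum_list Z) (\<Sum>z\<leftarrow>Z. z\<^sup>2)) = cost1 Z (mean Z)"
  by (auto simp: window_cost_def cost1_mean power2_eq_square)

lemma windows_Cons: "n \<le> length xs \<Longrightarrow> windows n (x # xs) = take n (x # xs) # windows n xs"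
  unfolding windows_def
  by (simp add: Suc_diff_le upt_conv_Cons map_Suc_upt[symmetric] comp_def del: upt_Suc)

lemma hd_windows: "\<exists>Ws. windows n xs = take n xs # Ws"
  unfolding windows_def by (simp add: upt_conv_Cons del: upt_Suc)

text \<open>Loop invariant: the sums are those of the first window of \<open>xs\<close>, which has
  already been compared, and \<open>W\<close> is the best window so far. Only the tail of the
  windows is still to be examined.\<close>

lemma run_slide:
  assumes "0 < n" "n \<le> length xs"
  shows "run (slide (real n) xs (drop n xs) (sum_list (take n xs)) (\<Sum>x\<leftarrow>take n xs. x\<^sup>2)
      (cost1 W (mean W)) (sum_list W))
    = sum_list (arg_min_list (\<lambda>Z. cost1 Z (mean Z)) (W # tl (windows n xs)))"
  using assms(2)
proof (induction xs arbitrary: W)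
  case Nil
  then show ?case using assms(1) by simp
next
  case (Cons x xs)
  show ?case
  proof (cases "n = length (x # xs)")
    case True
    then show ?thesis by (simp add: windows_def)
  next
    case False
    then have n_le: "n \<le> length xs" using Cons.prems by simp
    obtain n' where n': "n = Suc n'" using assms(1) by (cases n) auto
    define y where "y = xs ! n'"
    have drop: "drop n (x # xs) = y # drop n xs"
      using n_le by (simp add: n' y_def Cons_nth_drop_Suc)
    \<comment> \<open>Consecutive windows share \<open>take n' xs\<close>: \<open>x\<close> leaves
      at the front and \<open>y\<close> enters at the back.\<close>
    have take: "take n (x # xs) = x # take n' xs" "take n xs = take n' xs @ [y]"
      using n_le by (simp_all add: n' y_def take_Suc_conv_app_nth)
    have sums: "sum_list (take n (x # xs)) - x + y = sum_list (take n xs)"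
      "(\<Sum>x\<leftarrow>take n (x # xs). x\<^sup>2) - x * x + y * y = (\<Sum>x\<leftarrow>take n xs. x\<^sup>2)"
      unfolding take by (simp_all add: power2_eq_square)
    have cost: "run (window_cost (real n) (sum_list (take n xs)) (\<Sum>x\<leftarrow>take n xs. x\<^sup>2))
        = cost1 (take n xs) (mean (take n xs))"
      using n_le assms(1) by (intro run_window_cost) simp_all
    obtain Ws where Ws: "windows n xs = take n xs # Ws" using hd_windows by blast
    have "windows n (x # xs) = take n (x # xs) # take n xs # Ws"
      using windows_Cons[OF n_le] Ws by simp
    then show ?thesis
      unfolding drop using Cons.IH[OF n_le] Ws
      by (simp add: sums cost arg_min_list_Cons2 del: take_Suc_Cons arg_min_list.simps sum_list.Cons)
  qed
qed

lemma run_coord_prog: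
  assumes "0 < n" "n \<le> length zs"
  shows "run (coord_prog n zs)
    = mean (arg_min_list (\<lambda>Z. cost1 Z (mean Z)) (windows n (sort zs)))"
proof -
  define xs where "xs = sort zs"
  have len: "n \<le> length xs" using assms(2) by (simp add: xs_def)
  obtain Ws where Ws: "windows n xs = take n xs # Ws" using hd_windows by blast
  let ?W = "arg_min_list (\<lambda>Z. cost1 Z (mean Z)) (windows n xs)"
  have "?W \<in> set (windows n xs)" by (rule arg_min_list_in) simp
  from length_window[OF this len] have "mean ?W = sum_list ?W / real n" by (simp add: mean_def)
  moreover have "run (window_cost (real n) (sum_list (take n xs)) (\<Sum>x\<leftarrow>take n xs. x\<^sup>2))
      = cost1 (take n xs) (mean (take n xs))"
    using len assms(1) by (intro run_window_cost) simp_all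
  ultimately show ?thesis
    using run_slide[OF assms(1) len, of "take n xs"] Ws
    by (simp add: coord_prog_def run_msort_eq run_sum_sq flip: xs_def)
qed

lemma run_center_prog:
  assumes "0 \<le> \<alpha>" "\<alpha> < 1" "A \<noteq> []" "distinct A" "set A \<subseteq> {..<dim_row P}"
  shows "run (center_prog \<alpha> P A) = center \<alpha> P (set A)"
proof -
  define n where "n = nat \<lceil>(1 - \<alpha>) * real (length A)\<rceil>"
  have "0 < (1 - \<alpha>) * real (length A)" using assms by simp
  moreover have "(1 - \<alpha>) * real (length A) \<le> real (length A)"
    using assms by (simp add: algebra_simps)
  ultimately have n: "0 < n" "n \<le> length A" unfolding n_def by linarith+
  have "run (coord_prog n (map (\<lambda>t. P $$ (t, j)) A)) = mean (best_window \<alpha> (coords P (set A) j))"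
    if "j < dim_col P" for j
    using that n assms by (simp add: run_coord_prog best_window_def coords_eq_mset n_def del: mset_map)
  then show ?thesis
    using assms(1) by (intro eq_vecI) (simp_all add: center_prog_def center_def run_window_length n_def vec_of_list_index)
qed


section \<open>Running time\<close>

lemma steps_bind [simp]: "steps (bind_prog p f) = steps p + steps (f (run p))"
  by (induction p) simp_all

lemma steps_traverse [simp]: "steps (traverse f xs) = (\<Sum>x\<leftarrow>xs. steps (f x))"
  by (induction xs) simp_all

lemma steps_merge: "steps (merge xs ys) \<le> length xs + length ys"
  by (induction xs ys rule: merge.induct) auto

text \<open>\<open>L\<close> bounds the depth of the recursion: both halves, even the larger one,
  fit under the next lower power of 2, and each level spends at most one comparison per
  element.\<close>

lemma steps_msort: "length xs \<le> 2 ^ L \<Longrightarrow> steps (msort xs) \<le> length xs * L"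
proof (induction L arbitrary: xs)
  case 0
  then show ?case by (subst msort.simps) simp
next
  case (Suc L)
  define h where "h = length xs div 2"
  show ?case
  proof (cases "length xs \<le> 1")
    case True
    then show ?thesis by (subst msort.simps) simp
  next
    case False
    have len: "length (run (msort ys)) = length ys" for ys :: "real list"
      using run_msort[of ys] by (metis size_mset)
    have "steps (msort (take h xs)) \<le> h * L" "steps (msort (drop h xs)) \<le> (length xs - h) * L"
      using Suc.IH[of "take h xs"] Suc.IH[of "drop h xs"] Suc.prems
      by (auto simp: h_def min_absorb2)
    moreover have "steps (merge (run (msort (take h xs))) (run (msort (drop h xs)))) \<le> length xs"
      using steps_merge[of "run (msort (take h xs))" "run (msort (drop h xs))"]
      by (simp add: len h_def)
    moreover have "h * L + (length xs - h) * L = length xs * L"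
      by (simp add: h_def flip: add_mult_distrib)
    ultimately show ?thesis using False
      by (subst msort.simps) (simp add: h_def[symmetric])
  qed
qed

lemma steps_first_ge: "steps (first_ge x ns) \<le> 2 * length ns"
  by (induction ns) auto

lemma steps_window_length: "steps (window_length \<alpha> m) \<le> 2 * m + 6"
  using steps_first_ge[of _ "[0..<Suc m]"] by (simp add: window_length_def del: upt_Suc)

lemma steps_sum_sq: "steps (sum_sq xs) = 3 * length xs + 1"
  by (induction xs) (auto split: prod.splits)

text \<open>Each move takes 6 operations to update the sums, 3 for the cost and 1
  comparison.\<close>

lemma steps_slide: "steps (slide n xs ys s q v b) \<le> 10 * length ys"
proof (induction n xs ys s q v b rule: slide.induct)
  case (1 n x xs y ys s q v b)
  then show ?case by (auto simp: window_cost_def)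
qed auto

text \<open>After sorting, 3 steps per element go to the initial sums and 10 to sliding. The 6 are
  the two constants, the first window cost and the final division.\<close>

lemma steps_coord_prog:
  assumes "length zs \<le> 2 ^ L"
  shows "steps (coord_prog n zs) \<le> length zs * L + 13 * length zs + 6"
proof -
  have len: "length (run (msort zs)) = length zs" using run_msort[of zs] by (metis size_mset)
  obtain s q where "run (sum_sq (take n (run (msort zs)))) = (s, q)" by fastforce
  then show ?thesis
    using steps_msort[OF assms]
      steps_slide[of "real n" "run (msort zs)" "drop n (run (msort zs))" s q
        "run (window_cost (real n) s q)" s]
    by (simp add: coord_prog_def steps_sum_sq len window_cost_def)
qed

text \<open>As \<open>A\<close> is nonempty, additive constants are absorbed into its length: 13 + 6
  = 19 per coordinate and 2 + 6 = 8 for the window length. The latter is computed once per part and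
  is absorbed using \<open>1 \<le> dim_col P\<close>.\<close>

lemma steps_center_prog:
  assumes "length A \<le> 2 ^ L" "A \<noteq> []" "1 \<le> dim_col P"
  shows "steps (center_prog \<alpha> P A) \<le> dim_col P * (length A * (L + 27))"
proof -
  define l where "l = length A"
  have l: "1 \<le> l" using assms(2) by (cases A) (auto simp: l_def)
  have "steps (coord_prog n (map (\<lambda>t. P $$ (t, j)) A)) \<le> l * (L + 19)" for n j
    using steps_coord_prog[of "map (\<lambda>t. P $$ (t, j)) A" L n] assms(1) l
    by (simp add: l_def algebra_simps)
  then have "(\<Sum>j\<leftarrow>[0..<dim_col P]. steps (coord_prog n (map (\<lambda>t. P $$ (t, j)) A)))
      \<le> dim_col P * (l * (L + 19))" for n
    using sum_list_mono[of "[0..<dim_col P]" _ "\<lambda>_. l * (L + 19)"] by (simp add: sum_list_triv)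
  moreover have "steps (window_length \<alpha> l) \<le> dim_col P * (8 * l)"
    using steps_window_length[of \<alpha> l] l mult_le_mono1[OF assms(3), of "8 * l"] by linarith
  ultimately have "steps (center_prog \<alpha> P A) \<le> dim_col P * (8 * l) + dim_col P * (l * (L + 19))"
    by (simp add: center_prog_def l_def[symmetric] add_le_mono)
  also have "\<dots> = dim_col P * (length A * (L + 27))"
    by (simp add: l_def algebra_simps)
  finally show ?thesis .
qed

text \<open>Lets the costs of the parts, each linear in its length for a common \<open>L\<close>,
  add up to a bound in \<open>m\<close>.\<close>

lemma sum_length_parts:
  assumes "indexed_partition (length parts) {..<m} (\<lambda>i. set (parts ! i))" "\<forall>A\<in>set parts. distinct A"
  shows "(\<Sum>A\<leftarrow>parts. length A) = m"
proof -
  have "(\<Sum>A\<leftarrow>parts. length A) = (\<Sum>i<length parts. card (set (parts ! i)))"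
    using assms(2) by (simp add: sum_list_sum_nth distinct_card lessThan_atLeast0)
  also have "\<dots> = card (\<Union>i<length parts. set (parts ! i))"
    using assms(1) by (intro card_UN_disjoint[symmetric])
      (auto simp: indexed_partition_def disjoint_family_on_def)
  finally show ?thesis using assms(1) by (simp add: indexed_partition_def)
qed

lemma steps_kmeans_prog:
  assumes part: "indexed_partition (length parts) {..<m} (\<lambda>i. set (parts ! i))"
    and distinct: "\<forall>A\<in>set parts. distinct A" and nonempty: "[] \<notin> set parts"
    and d: "1 \<le> dim_col P" and m: "2 \<le> m"
  shows "real (steps (kmeans_prog \<alpha> P parts))
    \<le> 29 * (real (dim_col P) * real m * log 2 (real m))"
proof -
  define L where "L = nat \<lceil>log 2 (real m)\<rceil>"
  have total: "(\<Sum>A\<leftarrow>parts. length A) = m" using part distinct by (rule sum_length_parts)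
  \<comment> \<open>Rounding up costs at most 1, so \<open>L + 27\<close> is at most
    \<open>log 2 m + 28\<close>; since the logarithm is at least 1 this is at most 29 times the
    logarithm.\<close>
  have "1 \<le> log 2 (real m)" using m by simp
  then have L: "log 2 (real m) \<le> real L" "real L + 27 \<le> 29 * log 2 (real m)"
    unfolding L_def by linarith+
  have "real m = 2 powr log 2 (real m)" using m by simp
  also have "\<dots> \<le> 2 powr real L" using L by (intro powr_mono) auto
  finally have m_le: "m \<le> 2 ^ L" by (simp add: powr_realpow)
  have "length A \<le> 2 ^ L" if "A \<in> set parts" for A
    using member_le_sum_list[of "length A" "map length parts"] that total m_le by simp
  then have "steps (kmeans_prog \<alpha> P parts) \<le> (\<Sum>A\<leftarrow>parts. dim_col P * (length A * (L + 27)))"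
    unfolding kmeans_prog_def steps_traverse using nonempty d
    by (intro sum_list_mono steps_center_prog) auto
  also have "\<dots> = dim_col P * (m * (L + 27))"
    by (simp add: sum_list_const_mult sum_list_mult_const total)
  finally have "real (steps (kmeans_prog \<alpha> P parts)) \<le> real (dim_col P * (m * (L + 27)))"
    by (rule of_nat_mono)
  also have "\<dots> = real (dim_col P) * real m * (real L + 27)"
    by simp
  also have "\<dots> \<le> real (dim_col P) * real m * (29 * log 2 (real m))"
    using L by (intro mult_left_mono) auto
  finally show ?thesis by simp
qed

theorem theorem7:
  shows "\<exists>K::real. \<forall>(m::nat) (d::nat) (k::nat) (\<alpha>::real) (P::real mat) (parts::nat list list).
     d \<ge> 1 \<and> k \<ge> 1 \<and> 0 \<le> \<alpha> \<and> \<alpha> < 1 / 2 \<and>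
     P \<in> carrier_mat m d \<and>
     length parts = k \<and> (\<forall>A\<in>set parts. distinct A) \<and>
     has_label_error_rate k P (\<lambda>i. set (parts ! i)) \<alpha> \<longrightarrow>
       (let C = run (kmeans_prog \<alpha> P parts) in
          C = map (\<lambda>A. center \<alpha> P (set A)) parts \<and>
          set C \<subseteq> carrier_vec d \<and>
          cost (points P {..<m}) (set C) \<le>
            (1 + (\<alpha> / (1 - \<alpha>) + 4 * \<alpha> / ((1 - 2 * \<alpha>) * (1 - \<alpha>)))) * OPT k P) \<and>
       (m \<ge> 2 \<longrightarrow> real (steps (kmeans_prog \<alpha> P parts)) \<le> K * (real d * real m * log 2 (real m)))"
proof (rule exI[of _ 29], intro allI impI)
  fix m d k :: nat and \<alpha> :: real and P :: "real mat" and parts :: "nat list list"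
  let ?K = "1 + (\<alpha> / (1 - \<alpha>) + 4 * \<alpha> / ((1 - 2 * \<alpha>) * (1 - \<alpha>)))"
  assume "d \<ge> 1 \<and> k \<ge> 1 \<and> 0 \<le> \<alpha> \<and> \<alpha> < 1 / 2 \<and> P \<in> carrier_mat m d \<and>
     length parts = k \<and> (\<forall>A\<in>set parts. distinct A) \<and>
     has_label_error_rate k P (\<lambda>i. set (parts ! i)) \<alpha>"
  then have d: "d \<ge> 1" and \<alpha>: "0 \<le> \<alpha>" "\<alpha> < 1 / 2" and dim: "dim_row P = m" "dim_col P = d"
    and k: "length parts = k" and distinct: "\<forall>A\<in>set parts. distinct A"
    and err: "has_label_error_rate k P (\<lambda>i. set (parts ! i)) \<alpha>"
    by blast+
  have part: "indexed_partition k {..<m} (\<lambda>i. set (parts ! i))"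
    and ne: "\<And>i. i < k \<Longrightarrow> set (parts ! i) \<noteq> {}"
    using err dim by (auto simp: has_label_error_rate_def)
  have nonempty: "[] \<notin> set parts"
    using ne k by (metis in_set_conv_nth list.set(1))
  have sub: "set A \<subseteq> {..<m}" if "A \<in> set parts" for A
    using part that k by (auto simp: indexed_partition_def in_set_conv_nth)
  have run: "run (kmeans_prog \<alpha> P parts) = map (\<lambda>A. center \<alpha> P (set A)) parts"
    unfolding kmeans_prog_def run_traverse comp_def
    using nonempty distinct sub \<alpha> dim by (intro map_cong refl run_center_prog) auto
  have "set (run (kmeans_prog \<alpha> P parts)) = (\<lambda>i. center \<alpha> P (set (parts ! i))) ` {..<k}"
    unfolding run using k by (force simp: in_set_conv_nth)
  then have "cost (points P {..<m}) (set (run (kmeans_prog \<alpha> P parts))) \<le> ?K * OPT k P"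
    using centers_cost[OF \<alpha> err] dim by simp
  moreover have "set (run (kmeans_prog \<alpha> P parts)) \<subseteq> carrier_vec d"
    unfolding run by (auto simp: center_def dim)
  moreover have "real (steps (kmeans_prog \<alpha> P parts)) \<le> 29 * (real d * real m * log 2 (real m))"
    if "m \<ge> 2"
    using steps_kmeans_prog[of parts m P \<alpha>] part k distinct nonempty d dim that by simp
  ultimately show "(let C = run (kmeans_prog \<alpha> P parts) in
          C = map (\<lambda>A. center \<alpha> P (set A)) parts \<and>
          set C \<subseteq> carrier_vec d \<and>
          cost (points P {..<m}) (set C) \<le> ?K * OPT k P) \<and>
       (m \<ge> 2 \<longrightarrow> real (steps (kmeans_prog \<alpha> P parts)) \<le> 29 * (real d * real m * log 2 (real m)))"
    using run by (simp add: Let_def)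
qed

end
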